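(* Let $A$ be a quandle. Then $C_0(A)=[A\times A,A\times A]$. In particular, $A$ is a trivial quandle if and only if $[A\times A,A\times A]=\Delta_A$, the diagonal relation on $A$.
   Context: A rack is a set $A$ with binary operations $\triangleleft,\triangleleft^{-1}$ such that $(x\triangleleft a)\triangleleft^{-1}a=x=(x\triangleleft^{-1}a)\triangleleft a$ and $(x\triangleleft a)\triangleleft b=(x\triangleleft b)\triangleleft(a\triangleleft b)$ for all $x,a,b\in A$. A quandle is a rack with $a\triangleleft a=a$ for all $a$. A quandle is trivial if $x\triangleleft a=x$ for all $x,a$. Unbracketed expressions are evaluated from left to right, and $\triangleleft^{1}=\triangleleft$. $C_0(A)$ is the connectedness congruence: $(x,y)\in C_0(A)$ if and only if there are $n\in\mathbb{N}$, $a_1,\dots,a_n\in A$ and $\delta_1,\dots,\delta_n\in\{-1,1\}$ with $y=x\triangleleft^{\delta_1}a_1\triangleleft^{\delta_2}a_2\cdots\triangleleft^{\delta_n}a_n$. For congruences $R,S$ on a rack $A$, $R\,\square\,S$ is the set of $(a,b,c,d)\in A^4$ with $(a,b),(d,c)\in R$ and $(a,d),(b,c)\in S$, and $[R,S]$ is the congruence on $A$ generated by the pairs $(x\triangleleft a\triangleleft^{-1}b\triangleleft c\triangleleft^{-1}d,\ x)$ with $x\in A$, $(a,b,c,d)\in R\,\square\,S$. $A\times A$ denotes the largest congruence. *)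

theory Defs
  imports Main
begin

locale rack =
  fixes A :: "'a set"
    and rt :: "'a \<Rightarrow> 'a \<Rightarrow> 'a"  (infixl \<open>\<triangleleft>\<close> 70)
    and rti :: "'a \<Rightarrow> 'a \<Rightarrow> 'a"  (infixl \<open>\<triangleleft>\<^sup>-\<close> 70)
  assumes closed: "\<lbrakk>x \<in> A; a \<in> A\<rbrakk> \<Longrightarrow> x \<triangleleft> a \<in> A"
    and inv_closed: "\<lbrakk>x \<in> A; a \<in> A\<rbrakk> \<Longrightarrow> x \<triangleleft>\<^sup>- a \<in> A"
    and right_inv: "\<lbrakk>x \<in> A; a \<in> A\<rbrakk> \<Longrightarrow> x \<triangleleft> a \<triangleleft>\<^sup>- a = x"
    and left_inv: "\<lbrakk>x \<in> A; a \<in> A\<rbrakk> \<Longrightarrow> x \<triangleleft>\<^sup>- a \<triangleleft> a = x"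
    and self_distrib: "\<lbrakk>x \<in> A; a \<in> A; b \<in> A\<rbrakk> \<Longrightarrow> x \<triangleleft> a \<triangleleft> b = (x \<triangleleft> b) \<triangleleft> (a \<triangleleft> b)"
begin

definition rt_pow :: "'a \<Rightarrow> int \<Rightarrow> 'a \<Rightarrow> 'a" where
  "rt_pow x \<delta> a = (if \<delta> = 1 then x \<triangleleft> a else x \<triangleleft>\<^sup>- a)"

text \<open>The list \<open>ps\<close> is \<open>[(\<delta>\<^sub>1, a\<^sub>1), \<dots>, (\<delta>\<^sub>n, a\<^sub>n)]\<close>. The empty list (\<open>n = 0\<close>) is allowed; excluding it
  would not change the relation, since \<open>x = x \<triangleleft> a \<triangleleft>\<^sup>- a\<close>.\<close>

definition connectedness :: "('a \<times> 'a) set" where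
  "connectedness = {(x, y). x \<in> A \<and> y \<in> A \<and>
     (\<exists>ps. set ps \<subseteq> {-1, 1} \<times> A \<and> y = foldl (\<lambda>z (\<delta>, a). rt_pow z \<delta> a) x ps)}"

definition congruence :: "('a \<times> 'a) set \<Rightarrow> bool" where
  "congruence R \<longleftrightarrow> equiv A R \<and>
     (\<forall>(x, y)\<in>R. \<forall>(a, b)\<in>R. (x \<triangleleft> a, y \<triangleleft> b) \<in> R \<and> (x \<triangleleft>\<^sup>- a, y \<triangleleft>\<^sup>- b) \<in> R)"

text \<open>Meaningful for \<open>X \<subseteq> A \<times> A\<close>; then the family below contains \<open>A \<times> A\<close>.\<close>

definition generated_congruence :: "('a \<times> 'a) set \<Rightarrow> ('a \<times> 'a) set" where
  "generated_congruence X = \<Inter> {R. congruence R \<and> X \<subseteq> R}"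

definition box :: "('a \<times> 'a) set \<Rightarrow> ('a \<times> 'a) set \<Rightarrow> ('a \<times> 'a \<times> 'a \<times> 'a) set" where
  "box R S = {(a, b, c, d) \<in> A \<times> A \<times> A \<times> A.
     (a, b) \<in> R \<and> (d, c) \<in> R \<and> (a, d) \<in> S \<and> (b, c) \<in> S}"

definition commutator :: "('a \<times> 'a) set \<Rightarrow> ('a \<times> 'a) set \<Rightarrow> ('a \<times> 'a) set" where
  "commutator R S = generated_congruence
     {(x \<triangleleft> a \<triangleleft>\<^sup>- b \<triangleleft> c \<triangleleft>\<^sup>- d, x) | x a b c d. x \<in> A \<and> (a, b, c, d) \<in> box R S}"

end

locale quandle = rack +
  assumes idem: "a \<in> A \<Longrightarrow> a \<triangleleft> a = a"

locale trivial_quandle = quandle +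
  assumes trivial: "\<lbrakk>x \<in> A; a \<in> A\<rbrakk> \<Longrightarrow> x \<triangleleft> a = x"

end

theory Submission
  imports Defs
begin

text \<open>
  Call a passage from \<open>x\<close> to \<open>x \<triangleleft> a\<close> or to \<open>x \<triangleleft>\<^sup>- a\<close> a translation step. The connectedness relation
  is the least equivalence relation on \<open>A\<close> that contains all translation steps (lemmas
  \<open>equiv_connectedness\<close> and \<open>connectedness_least\<close>). Both inclusions come from comparing it with the
  congruences that contain the generators \<open>(x \<triangleleft> a \<triangleleft>\<^sup>- b \<triangleleft> c \<triangleleft>\<^sup>- d, x)\<close>, where for the commutator
  \<open>[A \<times> A, A \<times> A]\<close> the elements \<open>a, b, c, d\<close> are arbitrary.

  Each generator joins two points by four translation steps, and connectedness is itself a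
  congruence, so the commutator lies inside connectedness.

  Conversely, a generator with \<open>c = d\<close> says \<open>x \<triangleleft> a \<triangleleft>\<^sup>- b \<sim> x\<close>. Idempotence enters by the
  choice \<open>a = x\<close>: since \<open>x \<triangleleft> x = x\<close>, this becomes \<open>x \<triangleleft>\<^sup>- b \<sim> x\<close>, a single translation step. Hence
  every congruence containing the generators contains all steps, and so contains connectedness.

  The statement on trivial quandles follows, because all translation steps are identities exactly
  when the least equivalence relation containing them is the diagonal.
\<close>

context rack
begin

lemma rt_pow_closed: "\<lbrakk>x \<in> A; a \<in> A\<rbrakk> \<Longrightarrow> rt_pow x \<delta> a \<in> A"
  by (simp add: rt_pow_def closed inv_closed)

lemma connectedness_step:
  assumes "x \<in> A" "a \<in> A"
  shows "(x, x \<triangleleft> a) \<in> connectedness" and "(x, x \<triangleleft>\<^sup>- a) \<in> connectedness"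
proof -
  show "(x, x \<triangleleft> a) \<in> connectedness"
    unfolding connectedness_def using assms
    by (auto simp: rt_pow_def closed intro!: exI[of _ "[(1, a)]"])
  show "(x, x \<triangleleft>\<^sup>- a) \<in> connectedness"
    unfolding connectedness_def using assms
    by (auto simp: rt_pow_def inv_closed intro!: exI[of _ "[(-1, a)]"])
qed

lemma connectedness_trans:
  assumes "(x, y) \<in> connectedness" and "(y, z) \<in> connectedness"
  shows "(x, z) \<in> connectedness"
proof -
  obtain ps qs where
    "x \<in> A" "set ps \<subseteq> {-1, 1} \<times> A" "y = foldl (\<lambda>z (\<delta>, a). rt_pow z \<delta> a) x ps"
    "z \<in> A" "set qs \<subseteq> {-1, 1} \<times> A" "z = foldl (\<lambda>z (\<delta>, a). rt_pow z \<delta> a) y qs"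
    using assms unfolding connectedness_def by auto
  then have "set (ps @ qs) \<subseteq> {-1, 1} \<times> A \<and> z = foldl (\<lambda>z (\<delta>, a). rt_pow z \<delta> a) x (ps @ qs)"
    by simp
  with \<open>x \<in> A\<close> \<open>z \<in> A\<close> show ?thesis
    unfolding connectedness_def by blast
qed

text \<open>A path of translation steps is absorbed one step at a time by transitivity. As only forward
  steps are assumed, symmetry of \<open>R\<close> supplies the inverse ones: \<open>x \<triangleleft>\<^sup>- a\<close> leads to
  \<open>x \<triangleleft>\<^sup>- a \<triangleleft> a = x\<close> by a forward step.\<close>

lemma connectedness_least:
  assumes R: "equiv A R" and step: "\<And>x a. \<lbrakk>x \<in> A; a \<in> A\<rbrakk> \<Longrightarrow> (x, x \<triangleleft> a) \<in> R"
  shows "connectedness \<subseteq> R"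
proof -
  have sym: "sym R" and trans: "trans R" and refl: "refl_on A R"
    using R by (auto simp: equiv_def)
  have inv_step: "(x, x \<triangleleft>\<^sup>- a) \<in> R" if "x \<in> A" "a \<in> A" for x a
  proof -
    have "(x \<triangleleft>\<^sup>- a, x) \<in> R"
      using step[of "x \<triangleleft>\<^sup>- a" a] that by (simp add: inv_closed left_inv)
    with sym show ?thesis by (rule symD)
  qed
  have "(x, foldl (\<lambda>z (\<delta>, a). rt_pow z \<delta> a) x ps) \<in> R"
    if "x \<in> A" "set ps \<subseteq> {-1, 1} \<times> A" for x ps
    using that
  proof (induction ps arbitrary: x)
    case Nil
    then show ?case using refl by (simp add: refl_onD)
  next
    case (Cons p ps)
    obtain \<delta> a where p: "p = (\<delta>, a)" and "a \<in> A"
      using Cons.prems by (cases p) auto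
    have "(x, rt_pow x \<delta> a) \<in> R"
      using Cons.prems \<open>a \<in> A\<close> by (simp add: rt_pow_def step inv_step)
    moreover have "(rt_pow x \<delta> a, foldl (\<lambda>z (\<delta>, a). rt_pow z \<delta> a) (rt_pow x \<delta> a) ps) \<in> R"
      using Cons.prems \<open>a \<in> A\<close> by (intro Cons.IH) (auto simp: rt_pow_closed)
    ultimately have "(x, foldl (\<lambda>z (\<delta>, a). rt_pow z \<delta> a) (rt_pow x \<delta> a) ps) \<in> R"
      by (rule transD[OF trans])
    then show ?case
      using p by simp
  qed
  then show ?thesis
    unfolding connectedness_def by auto
qed

text \<open>Symmetry holds because every translation step is undone by the inverse translation by the
  same element.\<close>

lemma equiv_connectedness: "equiv A connectedness"
proof (rule equivI)
  show "connectedness \<subseteq> A \<times> A"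
    by (auto simp: connectedness_def)
  show "refl_on A connectedness"
    by (auto simp: refl_on_def connectedness_def intro!: exI[of _ "[]"])
  show "trans connectedness"
    by (rule transI) (rule connectedness_trans)
  show "sym connectedness"
  proof (rule symI)
    fix x y
    have "(foldl (\<lambda>z (\<delta>, a). rt_pow z \<delta> a) x ps, x) \<in> connectedness"
      if "x \<in> A" "set ps \<subseteq> {-1, 1} \<times> A" for x ps
      using that
    proof (induction ps arbitrary: x)
      case Nil
      then show ?case by (auto simp: connectedness_def intro!: exI[of _ "[]"])
    next
      case (Cons p ps)
      obtain \<delta> a where p: "p = (\<delta>, a)" and "a \<in> A"
        using Cons.prems by (cases p) auto
      have "(foldl (\<lambda>z (\<delta>, a). rt_pow z \<delta> a) (rt_pow x \<delta> a) ps, rt_pow x \<delta> a) \<in> connectedness"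
        using Cons.prems \<open>a \<in> A\<close> by (intro Cons.IH) (auto simp: rt_pow_closed)
      moreover have "(rt_pow x \<delta> a, x) \<in> connectedness"
        using connectedness_step[of "rt_pow x \<delta> a" a] Cons.prems \<open>a \<in> A\<close>
        by (auto simp: rt_pow_def closed inv_closed right_inv left_inv split: if_splits)
      ultimately show ?case
        unfolding p by (simp add: connectedness_trans)
    qed
    then show "(y, x) \<in> connectedness" if "(x, y) \<in> connectedness"
      using that unfolding connectedness_def by auto
  qed
qed

text \<open>Compatibility with the operations is immediate: translating moves a point only
  within its class, so \<open>x \<triangleleft> a \<sim> x \<sim> y \<sim> y \<triangleleft> b\<close> whatever \<open>a\<close> and \<open>b\<close> are.\<close>

lemma congruence_connectedness: "congruence connectedness"
  unfolding congruence_def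
proof (intro conjI ballI, rule equiv_connectedness, clarify)
  fix x y a b
  assume xy: "(x, y) \<in> connectedness" and "(a, b) \<in> connectedness"
  then have "x \<in> A" "y \<in> A" "a \<in> A" "b \<in> A"
    by (auto simp: connectedness_def)
  have sym: "(v, u) \<in> connectedness" if "(u, v) \<in> connectedness" for u v
    using equiv_connectedness that unfolding equiv_def by (blast dest: symD)
  show "(x \<triangleleft> a, y \<triangleleft> b) \<in> connectedness \<and> (x \<triangleleft>\<^sup>- a, y \<triangleleft>\<^sup>- b) \<in> connectedness"
    using xy connectedness_step[OF \<open>x \<in> A\<close> \<open>a \<in> A\<close>] connectedness_step[OF \<open>y \<in> A\<close> \<open>b \<in> A\<close>]
    by (meson sym connectedness_trans)
qed

lemma commutator_subset_connectedness: "commutator R S \<subseteq> connectedness"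
proof -
  have "(x \<triangleleft> a \<triangleleft>\<^sup>- b \<triangleleft> c \<triangleleft>\<^sup>- d, x) \<in> connectedness"
    if "x \<in> A" "(a, b, c, d) \<in> box R S" for x a b c d
  proof -
    have A: "a \<in> A" "b \<in> A" "c \<in> A" "d \<in> A"
      using that by (auto simp: box_def)
    have "(x, x \<triangleleft> a \<triangleleft>\<^sup>- b \<triangleleft> c \<triangleleft>\<^sup>- d) \<in> connectedness"
      using that(1) A
      by (intro connectedness_trans[OF connectedness_step(1)[of x a]]
          connectedness_trans[OF connectedness_step(2)[of "x \<triangleleft> a" b]]
          connectedness_trans[OF connectedness_step(1)[of "x \<triangleleft> a \<triangleleft>\<^sup>- b" c]]
          connectedness_step(2)) (simp_all add: closed inv_closed)
    then show ?thesis
      using equiv_connectedness unfolding equiv_def by (blast dest: symD)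
  qed
  then show ?thesis
    unfolding commutator_def generated_congruence_def
    by (intro Inter_lower) (auto simp: congruence_connectedness)
qed

end

context quandle
begin

lemma connectedness_subset_commutator: "connectedness \<subseteq> commutator (A \<times> A) (A \<times> A)"
  unfolding commutator_def generated_congruence_def
proof (rule Inter_greatest, clarify del: subsetI)
  fix R
  assume "congruence R"
    and gen: "{(x \<triangleleft> a \<triangleleft>\<^sup>- b \<triangleleft> c \<triangleleft>\<^sup>- d, x) | x a b c d. x \<in> A \<and> (a, b, c, d) \<in> box (A \<times> A) (A \<times> A)} \<subseteq> R"
  then have "equiv A R"
    by (simp add: congruence_def)
  then show "connectedness \<subseteq> R"
  proof (rule connectedness_least)
    fix x a
    assume "x \<in> A" "a \<in> A"
    \<comment> \<open>The generator at \<open>y = x \<triangleleft> a\<close> with first parameter \<open>y\<close> itself and the others \<open>a\<close>: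
        by idempotence its left component is \<open>y \<triangleleft>\<^sup>- a = x\<close>.\<close>
    define y where "y = x \<triangleleft> a"
    have "y \<in> A" "y \<triangleleft>\<^sup>- a = x"
      using \<open>x \<in> A\<close> \<open>a \<in> A\<close> by (simp_all add: y_def closed right_inv)
    have "(y, a, a, a) \<in> box (A \<times> A) (A \<times> A)"
      using \<open>y \<in> A\<close> \<open>a \<in> A\<close> by (simp add: box_def)
    with gen \<open>y \<in> A\<close> have "(y \<triangleleft> y \<triangleleft>\<^sup>- a \<triangleleft> a \<triangleleft>\<^sup>- a, y) \<in> R"
      by blast
    also have "y \<triangleleft> y \<triangleleft>\<^sup>- a \<triangleleft> a \<triangleleft>\<^sup>- a = x"
      using \<open>x \<in> A\<close> \<open>y \<in> A\<close> \<open>a \<in> A\<close> \<open>y \<triangleleft>\<^sup>- a = x\<close> by (simp add: idem right_inv)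
    finally show "(x, x \<triangleleft> a) \<in> R"
      by (simp add: y_def)
  qed
qed

lemma trivial_iff_connectedness_diagonal:
  "trivial_quandle A (\<triangleleft>) (\<triangleleft>\<^sup>-) \<longleftrightarrow> connectedness = Id_on A"
proof
  assume "trivial_quandle A (\<triangleleft>) (\<triangleleft>\<^sup>-)"
  then interpret trivial_quandle A "(\<triangleleft>)" "(\<triangleleft>\<^sup>-)" .
  have "equiv A (Id_on A)"
    by (auto simp: equiv_def refl_on_def sym_def trans_def)
  then have "connectedness \<subseteq> Id_on A"
    by (rule connectedness_least) (simp add: trivial Id_onI)
  moreover have "Id_on A \<subseteq> connectedness"
    using equiv_connectedness by (auto simp: equiv_def refl_on_def)
  ultimately show "connectedness = Id_on A"
    by blast
next
  assume "connectedness = Id_on A"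
  then have "x \<triangleleft> a = x" if "x \<in> A" "a \<in> A" for x a
    using connectedness_step(1)[OF that] by auto
  then show "trivial_quandle A (\<triangleleft>) (\<triangleleft>\<^sup>-)"
    by unfold_locales
qed

end

theorem corollary3p1p8:
  fixes A :: "'a set" and rt rti :: "'a \<Rightarrow> 'a \<Rightarrow> 'a"
  assumes "quandle A rt rti"
  shows "rack.connectedness A rt rti = rack.commutator A rt rti (A \<times> A) (A \<times> A) \<and>
    (trivial_quandle A rt rti \<longleftrightarrow> rack.commutator A rt rti (A \<times> A) (A \<times> A) = Id_on A)"
proof -
  interpret quandle A rt rti
    by (rule assms)
  have "connectedness = commutator (A \<times> A) (A \<times> A)"
    using connectedness_subset_commutator commutator_subset_connectedness by blast
  then show ?thesis
    using trivial_iff_connectedness_diagonal by simp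
qed

end
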